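(* Let $n>10^{20}$ be an integer with $\gcd(n,6)=1$, and let $G=\mathbb{Z}/n$. Let $S=(a_1)(a_2)(a_3)(a_4)$ be a minimal zero-sum sequence of length $4$ over $G$ such that $\gcd(n,a_i)=1$ for all $i=1,2,3,4$. Then $\operatorname{ind}(S)=1$.
   Context: A sequence of length $k$ over $G=\mathbb{Z}/n$ is a multiset-like list $(a_1)\cdots(a_k)$ of elements of $G$; each element is identified with an integer, here taken with $1\le a_j\le n$. It is a zero-sum sequence if $\sum_j a_j\equiv 0\pmod n$, and a minimal zero-sum sequence if it is zero-sum but no proper nontrivial subsequence is zero-sum. For an integer $x$, $(x)_n$ denotes the least non-negative integer congruent to $x$ modulo $n$. The index of $S=(a_1)\cdots(a_k)$ (with $1\le a_j\le n$) is $\operatorname{ind}(S)=\min\left\{\frac1n\sum_{j=1}^k (g a_j)_n : g\in(\mathbb{Z}/n)^*\right\}$, where $(\mathbb{Z}/n)^*$ is the group of units modulo $n$. *)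

theory Defs
  imports Complex_Main "HOL-Library.Multiset" "HOL-Number_Theory.Totient"
begin

text \<open>
  A residue class modulo \<open>n\<close> is identified with its representative in \<open>{1..n}\<close>, so the zero class
  is represented by \<open>n\<close>. A sequence over the integers modulo \<open>n\<close> is considered up to reordering,
  and its subsequences are then the submultisets.
\<close>

definition seq_over :: "nat \<Rightarrow> nat multiset \<Rightarrow> bool" where
  "seq_over n S \<longleftrightarrow> set_mset S \<subseteq> {1..n}"

definition zero_sum :: "nat \<Rightarrow> nat multiset \<Rightarrow> bool" where
  "zero_sum n S \<longleftrightarrow> [\<Sum>\<^sub># S = 0] (mod n)"

definition minimal_zero_sum :: "nat \<Rightarrow> nat multiset \<Rightarrow> bool" where
  "minimal_zero_sum n S \<longleftrightarrow>
     zero_sum n S \<and> (\<forall>T. T \<subset># S \<and> T \<noteq> {#} \<longrightarrow> \<not> zero_sum n T)"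

text \<open>
  The units modulo \<open>n\<close> are represented by \<open>totatives n\<close>, the integers in \<open>{1..n}\<close> coprime to \<open>n\<close>.
\<close>

definition ind :: "nat \<Rightarrow> nat multiset \<Rightarrow> real" where
  "ind n S = Min ((\<lambda>g. (1 / real n) * (\<Sum>a\<in>#S. real ((g * a) mod n))) ` totatives n)"

text \<open>For positive \<open>n\<close> the minimum ranges over a finite nonempty set, so it is attained.\<close>

lemma ind_attained:
  assumes "n > 0"
  shows "\<exists>g\<in>totatives n. ind n S = (1 / real n) * (\<Sum>a\<in>#S. real ((g * a) mod n))"
proof -
  have "1 \<in> totatives n"
    using assms by (simp add: totatives_def)
  then have "totatives n \<noteq> {}"
    by blast
  then have "ind n S \<in> (\<lambda>g. (1 / real n) * (\<Sum>a\<in>#S. real ((g * a) mod n))) ` totatives n"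
    unfolding ind_def by (intro Min_in) auto
  then show ?thesis
    by blast
qed

end

theory Submission
  imports Defs
begin

text \<open>
  If no unit \<open>g\<close> gives residue sum \<open>n\<close>, then none gives \<open>3 n\<close> either (replace \<open>g\<close> by \<open>-g\<close>), so all give
  \<open>2 n\<close>. Comparing \<open>g\<close> with \<open>2 g\<close>, exactly two of the four residues \<open>g a\<^sub>j\<close> lie below \<open>n / 2\<close>: the
  square wave \<open>s\<close> of period \<open>n\<close> satisfies \<open>\<Sum>\<^sub>j s (g a\<^sub>j) = 0\<close> for every unit \<open>g\<close>.

  Multiply by \<open>sin (2 \<pi> a\<^sub>i g / n)\<close> and sum over the units. This gives \<open>\<Sum>\<^sub>j T (a\<^sub>i / a\<^sub>j) = 0\<close>, where
  \<open>T b\<close> is the normalised sum of \<open>sin (2 \<pi> b g / n) s g\<close> over the units. By the Fourier expansion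
  of \<open>s\<close>, \<open>T b\<close> is essentially the sum of \<open>c (b - m) / (m \<phi>(n))\<close> over the odd \<open>m\<close> with
  \<open>\<bar>m\<bar> < n\<close>, where \<open>c\<close> is the Ramanujan sum, and
  \<open>\<bar>c k\<bar> / \<phi>(n) \<le> 1 / \<phi>(n / gcd n k)\<close>. The \<open>m\<close> for which this quotient is not small are more than
  \<open>\<surd>n\<close> apart, so at most one term matters. Hence, up to \<open>1/60\<close>, \<open>T 1 \<ge> 0.99\<close> and
  \<open>T b \<ge> -1/4\<close> unless \<open>b = -1\<close>, which minimality excludes for the ratios, or \<open>b = -3\<close>, where
  \<open>T b \<ge> -1/3\<close>. The sum can only vanish if \<open>a\<^sub>i = -3 a\<^sub>j\<close> for all \<open>j \<noteq> i\<close>. Exchanging the roles of two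
  indices, \<open>a\<^sub>1 = 9 a\<^sub>1\<close>, so \<open>n\<close> divides \<open>8\<close>.
\<close>

section \<open>Ramanujan sums\<close>

definition unity :: "nat \<Rightarrow> int \<Rightarrow> complex" where
  "unity n k = cis (2 * pi * of_int k / of_nat n)"

lemma unity_add: "unity n (j + k) = unity n j * unity n k"
  by (simp add: unity_def cis_mult add_divide_distrib distrib_left)

lemma unity_multiple:
  assumes "n > 0"
  shows "unity n (int n * k) = 1"
  using assms by (simp add: unity_def mult.assoc[symmetric] cis_multiple_2pi)

lemma unity_cong:
  assumes "n > 0" "[j = k] (mod int n)"
  shows "unity n j = unity n k"
proof -
  obtain t where "j = k + int n * t"
    using assms(2) by (metis cong_iff_lin cong_sym)
  then show ?thesis
    using assms(1) by (simp add: unity_add unity_multiple)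
qed

lemma unity_mult_cancel:
  assumes "p > 0"
  shows "unity (p * e) (int p * k) = unity e k"
  using assms by (simp add: unity_def mult.assoc)

lemma unity_power: "unity n k ^ t = unity n (int t * k)"
  by (simp add: unity_def DeMoivre mult_ac)

lemma unity_eq_1_iff:
  assumes "n > 0"
  shows "unity n k = 1 \<longleftrightarrow> int n dvd k"
proof
  assume "unity n k = 1"
  then have "cos (2 * pi * of_int k / of_nat n) = 1"
    by (metis unity_def cis.sel(1) one_complex.sel(1))
  then obtain j :: int where "2 * pi * of_int k / of_nat n = of_int j * 2 * pi"
    using cos_one_2pi_int by auto
  then have "real_of_int k = of_int (j * int n)"
    using assms by (simp add: field_simps)
  then have "k = j * int n"
    by (simp only: of_int_eq_iff)
  then show "int n dvd k"
    by simp
next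
  assume "int n dvd k"
  then show "unity n k = 1"
    using unity_multiple[OF assms] by auto
qed

text \<open>Representatives run from 0 to n - 1, so that reduction by \<open>mod n\<close> stays
  among them. For n = 1 this leaves the class 0, where the induction on n starts.\<close>

definition units_below :: "nat \<Rightarrow> nat set" where
  "units_below n = {x. x < n \<and> coprime x n}"

lemma finite_units_below [simp]: "finite (units_below n)"
  by (simp add: units_below_def)

lemma totatives_eq_units_below: "n > 1 \<Longrightarrow> totatives n = units_below n"
  by (auto simp: totatives_def units_below_def order_le_less intro: Nat.gr0I)

lemma card_units_below: "n > 0 \<Longrightarrow> card (units_below n) = totient n"
proof (cases "n = 1")
  case True
  then have "units_below n = {0}" by (auto simp: units_below_def)
  with True show ?thesis by simp
next
  case False
  assume "n > 0"
  with False show ?thesis by (simp add: totient_def totatives_eq_units_below)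
qed

lemma sum_units_below_mult:
  fixes f :: "nat \<Rightarrow> 'a :: comm_ring_1"
  assumes "n > 0" "coprime u n" "\<And>x. f (x mod n) = f x"
  shows "(\<Sum>x\<in>units_below n. f (u * x)) = (\<Sum>x\<in>units_below n. f x)"
proof -
  have inj: "inj_on (\<lambda>x. u * x mod n) (units_below n)"
  proof (rule inj_onI)
    fix x y assume "x \<in> units_below n" "y \<in> units_below n" "u * x mod n = u * y mod n"
    then have "[u * x = u * y] (mod n)" "x < n" "y < n"
      by (auto simp: units_below_def cong_def)
    then have "[x = y] (mod n)"
      using assms(2) cong_mult_lcancel_nat by blast
    then show "x = y" using \<open>x < n\<close> \<open>y < n\<close> by (simp add: cong_def)
  qed
  have "(\<lambda>x. u * x mod n) ` units_below n \<subseteq> units_below n"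
    using assms(1,2) by (auto simp: units_below_def)
  then have "bij_betw (\<lambda>x. u * x mod n) (units_below n) (units_below n)"
    using endo_inj_surj[OF finite_units_below _ inj] inj unfolding bij_betw_def by blast
  from sum.reindex_bij_betw[OF this, of f] show ?thesis
    using assms(3) by simp
qed

definition ramanujan_sum :: "nat \<Rightarrow> int \<Rightarrow> complex" where
  "ramanujan_sum n m = (\<Sum>x\<in>units_below n. unity n (int x * m))"

lemma ramanujan_sum_mult_unit:
  assumes "n > 0" "coprime u n"
  shows "ramanujan_sum n (int u * m) = ramanujan_sum n m"
proof -
  have "unity n (int (x mod n) * m) = unity n (int x * m)" for x
    by (rule unity_cong[OF assms(1)]) (simp add: cong_def zmod_int mod_mult_left_eq)
  from sum_units_below_mult[OF assms, of "\<lambda>x. unity n (int x * m)", OF this] show ?thesis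
    by (simp add: ramanujan_sum_def mult_ac)
qed

lemma sum_coprime_blocks:
  fixes f :: "nat \<Rightarrow> 'a :: comm_monoid_add"
  shows "(\<Sum>x | x < p * e \<and> coprime x e. f x) =
    (\<Sum>y\<in>units_below e. \<Sum>t<p. f (y + e * t))"
proof -
  have "(\<Sum>x | x < p * e \<and> coprime x e. f x) = (\<Sum>x<p * e. if coprime x e then f x else 0)"
    by (simp add: sum.If_cases Int_def)
  also have "\<dots> = (\<Sum>t<p. \<Sum>x = t * e..<t * e + e. if coprime x e then f x else 0)"
    by (rule sum.nat_group[symmetric])
  also have "\<dots> = (\<Sum>t<p. \<Sum>y<e. if coprime y e then f (y + e * t) else 0)"
  proof (rule sum.cong[OF refl])
    fix t
    have cop: "coprime (y + t * e) e \<longleftrightarrow> coprime y e" for y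
      using gcd_add_mult[of e t y] by (metis coprime_iff_gcd_eq_1 gcd.commute add.commute)
    have "(\<Sum>x = t * e..<t * e + e. if coprime x e then f x else 0) =
        (\<Sum>y = 0..<e. if coprime (y + t * e) e then f (y + t * e) else 0)"
      using sum.shift_bounds_nat_ivl[of "\<lambda>x. if coprime x e then f x else 0" 0 "t * e" e]
      by (simp add: add.commute)
    also have "\<dots> = (\<Sum>y = 0..<e. if coprime y e then f (y + t * e) else 0)"
      by (simp only: cop)
    finally show "(\<Sum>x = t * e..<t * e + e. if coprime x e then f x else 0) =
        (\<Sum>y<e. if coprime y e then f (y + e * t) else 0)"
      unfolding lessThan_atLeast0 mult.commute[of e t] .
  qed
  also have "\<dots> = (\<Sum>t<p. \<Sum>y\<in>units_below e. f (y + e * t))"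
    by (simp add: sum.If_cases units_below_def Int_def)
  finally show ?thesis
    by (subst sum.swap)
qed

text \<open>Writing x = y + e t separates the class y modulo e from a geometric series over t in the
  root of unity \<open>unity p m\<close>, which vanishes unless p divides m. This links Ramanujan
  sums modulo \<open>p * e\<close> to those modulo e.\<close>

lemma sum_unity_blocks:
  assumes "p > 0" "e > 0"
  shows "(\<Sum>x | x < p * e \<and> coprime x e. unity (p * e) (int x * m)) =
    (if int p dvd m then of_nat p * ramanujan_sum e (m div int p) else 0)"
proof (cases "int p dvd m")
  case True
  then obtain k where k: "m = int p * k" by blast
  have "unity (p * e) (int (y + e * t) * m) = unity e (int y * k)" for y t
  proof -
    have "unity (p * e) (int (y + e * t) * m) = unity e (int (y + e * t) * k)"
      using unity_mult_cancel[OF assms(1), of e "int (y + e * t) * k"] by (simp add: k mult_ac)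
    also have "\<dots> = unity e (int y * k)"
      by (rule unity_cong[OF assms(2)]) (simp add: cong_iff_dvd_diff algebra_simps)
    finally show ?thesis .
  qed
  with True assms show ?thesis
    unfolding sum_coprime_blocks
    by (simp add: ramanujan_sum_def sum_distrib_left k)
next
  case False
  have "(\<Sum>t<p. unity (p * e) (int (y + e * t) * m)) = 0" for y
  proof -
    have eq: "unity (p * e) (int (y + e * t) * m) = unity (p * e) (int y * m) * unity p m ^ t" for t
    proof -
      have "unity (p * e) (int (e * t) * m) = unity p (int t * m)"
        using unity_mult_cancel[OF assms(2), of p "int t * m"] by (simp add: mult_ac)
      then show ?thesis
        by (simp add: unity_power unity_add distrib_right)
    qed
    have "unity p m \<noteq> 1" "unity p m ^ p = 1"
      using False assms by (simp_all add: unity_eq_1_iff unity_power)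
    then have "(\<Sum>t<p. unity p m ^ t) = 0"
      by (simp add: geometric_sum)
    then show ?thesis
      by (simp only: eq flip: sum_distrib_left) simp
  qed
  with False show ?thesis
    by (simp add: sum_coprime_blocks)
qed

lemma totient_mult_prime:
  assumes "prime p"
  shows "totient (p * e) = (if p dvd e then p * totient e else (p - 1) * totient e)"
proof (cases "p dvd e")
  case True
  have "p > 1" using assms prime_gt_1_nat by blast
  then show ?thesis
    using True by (simp add: totient_mult gcd_nat.absorb1 totient_prime[OF assms])
next
  case False
  then show ?thesis
    using assms by (simp add: totient_mult_coprime prime_imp_coprime totient_prime)
qed

text \<open>One prime factor is split off at a time, and p may still divide e. For totients and
  Ramanujan sums this leaves the two cases \<open>p dvd e\<close> and its negation, with no prime
  powers to handle.\<close>

lemma prime_factor_cofactor_induct [consumes 1, case_names one prime]: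
  fixes n :: nat
  assumes "n > 0" "P 1"
    "\<And>p e. prime p \<Longrightarrow> e > 0 \<Longrightarrow> P e \<Longrightarrow> P (p * e)"
  shows "P n"
  using assms(1)
proof (induction n rule: less_induct)
  case (less n)
  show ?case
  proof (cases "n = 1")
    case False
    then obtain p where p: "prime p" "p dvd n"
      using prime_factor_nat by blast
    then obtain e where e: "n = p * e" by blast
    have "e > 0" "e < n"
      using e less.prems prime_gt_1_nat[OF p(1)] by auto
    then show ?thesis
      using less.IH assms(3) p(1) e by blast
  qed (use assms(2) in simp)
qed

text \<open>For positive n, the denominator of m / n in lowest terms, which is the order of the root
  of unity \<open>unity n m\<close>.\<close>

definition reduced_denominator :: "nat \<Rightarrow> int \<Rightarrow> nat" where
  "reduced_denominator n m = n div nat (gcd (int n) m)"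

lemma reduced_denominator_mult:
  assumes "p > 0"
  shows "reduced_denominator (p * e) (int p * k) = reduced_denominator e k"
  using assms by (simp add: reduced_denominator_def gcd_mult_left nat_mult_distrib)

text \<open>By Hoelder's formula the Ramanujan sum equals mu(d) phi(n) / phi(d), d being the reduced
  denominator. The bound is obtained directly by splitting off a prime p: the sum over all x coprime
  to e is known from \<open>sum_unity_blocks\<close>. If p divides e, it is the Ramanujan sum modulo
  \<open>p * e\<close>; otherwise the multiples of p have to be removed, and they contribute
  \<open>ramanujan_sum e m\<close>.\<close>

lemma norm_ramanujan_sum_le:
  assumes "n > 0"
  shows "cmod (ramanujan_sum n m) * totient (reduced_denominator n m) \<le> totient n"
  using assms
proof (induction n arbitrary: m rule: prime_factor_cofactor_induct)
  case one
  have "units_below 1 = {0}" by (auto simp: units_below_def)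
  then show ?case by (simp add: ramanujan_sum_def unity_def reduced_denominator_def)
next
  case (prime p e)
  note p = \<open>prime p\<close>
  have p1: "p > 1" using p prime_gt_1_nat by blast
  let ?V = "\<Sum>x | x < p * e \<and> coprime x e. unity (p * e) (int x * m)"
  have V: "?V = (if int p dvd m then of_nat p * ramanujan_sum e (m div int p) else 0)"
    using sum_unity_blocks p1 \<open>e > 0\<close> by simp
  show ?case
  proof (cases "p dvd e")
    case True
    have "coprime x (p * e) \<longleftrightarrow> coprime x e" for x
      using True p1 by (metis coprime_mult_right_iff coprime_divisors dvd_refl)
    then have R: "ramanujan_sum (p * e) m = ?V"
      by (simp add: ramanujan_sum_def units_below_def)
    show ?thesis
    proof (cases "int p dvd m")
      case pm: True
      then obtain k where k: "m = int p * k" by blast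
      have "ramanujan_sum (p * e) m = of_nat p * ramanujan_sum e k"
        using R V p1 k by simp
      moreover have "reduced_denominator (p * e) m = reduced_denominator e k"
        using p1 by (simp only: k reduced_denominator_mult)
      ultimately show ?thesis
        using True mult_left_mono[OF prime.IH[of k], of "real p"]
        by (simp add: norm_mult totient_mult_prime[OF p] mult.assoc)
    next
      case False
      then show ?thesis using R V by simp
    qed
  next
    case False
    have cop: "coprime p e" using False p prime_imp_coprime by blast
    have cop_iff: "coprime x (p * e) \<longleftrightarrow> coprime x e \<and> \<not> p dvd x" for x
      using p by (metis coprime_commute coprime_mult_right_iff prime_imp_coprime
          coprime_absorb_left not_prime_unit)
    have split: "{x. x < p * e \<and> coprime x e} = units_below (p * e) \<union> (\<lambda>y. p * y) ` units_below e"
      (is "?A = ?B \<union> ?C")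
    proof (intro equalityI subsetI)
      fix x assume x: "x \<in> ?A"
      show "x \<in> ?B \<union> ?C"
      proof (cases "p dvd x")
        case True
        then obtain y where "x = p * y" by blast
        with x p1 show ?thesis by (auto simp: units_below_def)
      qed (use x cop_iff in \<open>auto simp: units_below_def\<close>)
    next
      fix x assume "x \<in> ?B \<union> ?C"
      then show "x \<in> ?A"
      proof
        assume "x \<in> ?C"
        then obtain y where "x = p * y" "y < e" "coprime y e"
          by (auto simp: units_below_def)
        with cop p1 show "x \<in> ?A" by simp
      qed (simp only: units_below_def cop_iff mem_Collect_eq)
    qed
    have "?B \<inter> ?C = {}"
      proof -
      have "\<not> coprime (p * y) (p * e)" for y
        unfolding cop_iff by simp
      then show ?thesis
        unfolding units_below_def by blast
    qed
    moreover have "finite ?A" by simp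
    ultimately have "?V = ramanujan_sum (p * e) m + (\<Sum>x\<in>?C. unity (p * e) (int x * m))"
      unfolding split ramanujan_sum_def by (intro sum.union_disjoint) auto
    also have "(\<Sum>x\<in>?C. unity (p * e) (int x * m)) = ramanujan_sum e m"
      using p1 unity_mult_cancel[of p e]
      by (subst sum.reindex) (auto simp: inj_on_def ramanujan_sum_def mult.assoc)
    finally have R: "ramanujan_sum (p * e) m = ?V - ramanujan_sum e m"
      by simp
    show ?thesis
    proof (cases "int p dvd m")
      case pm: True
      then obtain k where k: "m = int p * k" by blast
      \<comment> \<open>Multiplication by p permutes the units modulo e.\<close>
      have "ramanujan_sum e m = ramanujan_sum e k"
        using ramanujan_sum_mult_unit[OF \<open>e > 0\<close> cop] k by simp
      then have "ramanujan_sum (p * e) m = (of_nat p - 1) * ramanujan_sum e k"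
        using R V p1 k by (simp add: algebra_simps)
      moreover have "cmod (of_nat p - 1) = real (p - 1)"
        using p1 by (metis norm_of_nat of_nat_1 of_nat_diff order_less_imp_le)
      moreover have "reduced_denominator (p * e) m = reduced_denominator e k"
        using p1 by (simp only: k reduced_denominator_mult)
      ultimately show ?thesis
        using False mult_left_mono[OF prime.IH[of k], of "real (p - 1)"]
        by (simp add: norm_mult totient_mult_prime[OF p] mult.assoc del: of_nat_diff)
    next
      case pm: False
      \<comment> \<open>Compared with the modulus e, the sum only changes its sign, while the
        reduced denominator acquires the new prime p. So both totients gain the factor p -
        1.\<close>
      then have neg: "ramanujan_sum (p * e) m = - ramanujan_sum e m"
        using R V by simp
      moreover have "gcd (int (p * e)) m = gcd (int e) m"
      proof -
        have "prime (int p)" using p by simp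
        then have "coprime (int p) m" using pm prime_imp_coprime by blast
        then show ?thesis by (simp add: gcd_mult_left_left_cancel coprime_commute)
      qed
      moreover define d where "d = reduced_denominator e m"
      moreover have h: "nat (gcd (int e) m) dvd e"
        by (metis gcd_dvd1 int_dvd_int_iff int_nat_eq gcd_ge_0_int)
      moreover have "d dvd e"
        unfolding d_def reduced_denominator_def using dvd_div_mult_self[OF h] by (metis dvd_triv_left)
      ultimately have "reduced_denominator (p * e) m = p * d" "d dvd e"
        by (simp_all only: reduced_denominator_def div_mult_swap)
      moreover have "\<not> p dvd d"
        using False \<open>d dvd e\<close> dvd_trans by blast
      ultimately show ?thesis
        using False neg mult_left_mono[OF prime.IH[of m], of "real (p - 1)"]
        by (simp add: totient_mult_prime[OF p] d_def[symmetric] mult.left_commute del: of_nat_diff)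
    qed
  qed
qed

section \<open>A lower bound for the totient of numbers coprime to 6\<close>

lemma coprime_6_ge_5:
  fixes d :: nat
  assumes "coprime d 6" "d > 1"
  shows "d \<ge> 5"
proof -
  have "\<not> coprime (3::nat) 6" "\<not> coprime (2::nat) 6" "\<not> coprime (4::nat) 6"
    by (rule not_coprimeI[of 3] not_coprimeI[of 2]; simp)+
  then have "d \<noteq> 2" "d \<noteq> 3" "d \<noteq> 4"
    using assms(1) by metis+
  with assms(2) show ?thesis
    by linarith
qed

text \<open>Each new prime factor p compares p^4 with (p - 1)^5, each repeated one p^4 with p^5. The
  first comparison holds from p = 5 on and fails for p = 2 and p = 3. The exponents are such that a
  totient below the fifth root of n forces d below the fourth root of n.\<close>

lemma totient_power_lower_bound:
  assumes "coprime d 6"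
  shows "d ^ 4 \<le> totient d ^ 5"
proof -
  have "d > 0" using assms by (auto intro: Nat.gr0I)
  then show ?thesis using assms
  proof (induction d rule: prime_factor_cofactor_induct)
    case (prime p e)
    have p: "coprime p 6" and e: "e ^ 4 \<le> totient e ^ 5"
      using prime by auto
    have p5: "p \<ge> 5"
      using coprime_6_ge_5[OF p] prime_gt_1_nat[OF prime(1)] by simp
    \<comment> \<open>In terms of q = p - 5 the claim p^4 <= (p - 1)^5 is a coefficientwise
      comparison of polynomials.\<close>
    then obtain q where q: "p = q + 5" using le_Suc_ex by (metis add.commute)
    have "(q + 5) ^ 4 \<le> (q + 4) ^ 5"
      by (simp add: power_numeral_even power_numeral_odd algebra_simps)
    moreover have "p - 1 = q + 4"
      by (simp add: q)
    ultimately have pp: "p ^ 4 \<le> (p - 1) ^ 5"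
      by (simp only: q)
    also have "\<dots> \<le> p ^ 5" by (simp add: power_mono)
    finally have pp': "p ^ 4 \<le> p ^ 5" .
    show ?case
      unfolding totient_mult_prime[OF prime(1)]
      using mult_mono[OF pp e] mult_mono[OF pp' e] by (simp add: power_mult_distrib)
  qed simp
qed

section \<open>The square wave\<close>

text \<open>
  Twice \<open>x mod n\<close> reduces modulo \<open>n\<close> without or with a carry according to the sign of the wave,
  which is why it is the square wave, and not the sawtooth, whose four dilates cancel below: its
  Fourier expansion has no even frequencies.
\<close>

definition square_wave :: "nat \<Rightarrow> nat \<Rightarrow> real" where
  "square_wave n y = (if 2 * (y mod n) < n then 1 else - 1)"

lemma sin_double_Suc_diff:
  "sin (2 * real (Suc N) * x) - sin (2 * real N * x) = 2 * sin x * cos (real (2 * N + 1) * x)"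
proof -
  have "(2 * real (Suc N) * x - 2 * real N * x) / 2 = x"
    "(2 * real (Suc N) * x + 2 * real N * x) / 2 = real (2 * N + 1) * x"
    by (simp_all add: field_simps)
  then show ?thesis
    by (simp only: sin_diff_sin)
qed

lemma sum_cos_odd_multiples:
  fixes x :: real
  assumes "sin x \<noteq> 0"
  shows "(\<Sum>j<N. cos (real (2 * j + 1) * x)) = sin (2 * real N * x) / (2 * sin x)"
proof -
  have "2 * sin x * (\<Sum>j<N. cos (real (2 * j + 1) * x)) = sin (2 * real N * x)"
  proof (induction N)
    case (Suc N)
    with sin_double_Suc_diff[of N x] show ?case
      by (simp add: distrib_left del: of_nat_Suc of_nat_add)
  qed simp
  with assms show ?thesis by (simp add: field_simps)
qed

text \<open>With x = k pi / n and 2 N = n - 1, the angle 2 N x is k pi - x, so the quotient of sines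
  in the closed form collapses to 1/2 up to sign.\<close>

lemma sum_cos_odd_frequencies:
  assumes "n = 2 * N + 1" "\<not> n dvd k"
  shows "(\<Sum>j<N. cos (real k * (real (2 * j + 1) * pi / real n))) = (if even k then - 1 / 2 else 1 / 2)"
proof -
  define x where "x = real k * pi / real n"
  have "sin x \<noteq> 0"
  proof
    assume "sin x = 0"
    then obtain i :: int where "x = of_int i * pi"
      by (auto simp: sin_zero_iff_int2)
    then have "pi * real k = pi * (of_int i * real n)"
      using assms(1) by (simp add: x_def divide_eq_eq mult_ac)
    then have "real k = of_int i * real n"
      by (subst (asm) mult_cancel_left) simp
    then have "int k = i * int n"
      by (metis of_int_eq_iff of_int_mult of_int_of_nat_eq)
    then show False
      using assms(2) by (metis dvd_triv_right int_dvd_int_iff)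
  qed
  note sum_cos_odd_multiples[OF this, of N]
  moreover have "sin (2 * real N * x) = (if even k then - sin x else sin x)"
  proof -
    have "2 * real N * x = real k * pi - x"
    proof -
      have "real n * x = real k * pi"
        using assms(1) by (simp add: x_def)
      then show ?thesis
        using assms(1) by (simp add: algebra_simps)
    qed
    then show ?thesis by (simp add: sin_diff)
  qed
  moreover have "(\<Sum>j<N. cos (real k * (real (2 * j + 1) * pi / real n))) =
      (\<Sum>j<N. cos (real (2 * j + 1) * x))"
    by (intro sum.cong refl arg_cong[of _ _ cos]) (simp add: x_def)
  ultimately show ?thesis
    using \<open>sin x \<noteq> 0\<close> by (simp del: of_nat_add of_nat_mult of_nat_Suc)
qed

lemma cot_half_mult_sin:
  assumes "sin (x / 2) \<noteq> 0"
  shows "cot (x / 2) * sin x = 1 + cos x"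
  using assms sin_double[of "x / 2"] cos_double_cos[of "x / 2"]
  by (simp add: cot_def power2_eq_square)

text \<open>As a function D of y, the sum has the increment 2 A(2 y + 1) + A(2 y + 2) + A(2 y) with
  the cosine sums A, because cot(t / 2) sin t = 1 + cos t. For 0 < y < N this is 1 - 1/2 - 1/2 = 0,
  so D is constant from 1 to N. The constant n / 2 comes from the exceptional value A 0 = N. The
  reflection of y to n - y changes the sign and settles the other half.\<close>

lemma sum_cot_sin_odd_frequencies:
  fixes y :: nat
  assumes n: "n = 2 * N + 1" and y: "0 < y" "y < n"
  shows "(\<Sum>j<N. cot (real (2 * j + 1) * pi / real n / 2) *
            sin (2 * real y * (real (2 * j + 1) * pi / real n))) =
          (if 2 * y < n then real n / 2 else - real n / 2)"
proof -
  define \<theta> where "\<theta> j = real (2 * j + 1) * pi / real n" for j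
  define A where "A k = (\<Sum>j<N. cos (real k * \<theta> j))" for k
  define D where "D y = (\<Sum>j<N. cot (\<theta> j / 2) * sin (2 * real y * \<theta> j))" for y
  have A: "A k = (if even k then - 1 / 2 else 1 / 2)" if "\<not> n dvd k" for k
    using sum_cos_odd_frequencies[OF n that] by (simp add: A_def \<theta>_def)
  have A0: "A 0 = real N"
    by (simp add: A_def)
  have \<theta>: "0 < \<theta> j" "\<theta> j < pi" if "j < N" for j
  proof -
    have "real (2 * j + 1) < real n"
      using that n by linarith
    then have "real (2 * j + 1) * pi < real n * pi"
      by simp
    then show "\<theta> j < pi"
      using n by (simp add: \<theta>_def divide_less_eq mult.commute)
  qed (simp add: \<theta>_def n)
  have step: "D (Suc y) = D y + 2 * A (2 * y + 1) + A (2 * y + 2) + A (2 * y)" for y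
  proof -
    have "cot (\<theta> j / 2) * sin (2 * real (Suc y) * \<theta> j) = cot (\<theta> j / 2) * sin (2 * real y * \<theta> j)
        + 2 * cos (real (2 * y + 1) * \<theta> j) + cos (real (2 * y + 2) * \<theta> j) + cos (real (2 * y) * \<theta> j)"
      if "j < N" for j
    proof -
      define t where "t = \<theta> j"
      have "sin (t / 2) > 0"
        using \<theta>[OF that] unfolding t_def by (intro sin_gt_zero) auto
      then have cot: "cot (t / 2) * sin t = 1 + cos t"
        by (intro cot_half_mult_sin) simp
      have "sin (2 * real (Suc y) * t) - sin (2 * real y * t) = 2 * sin t * cos (real (2 * y + 1) * t)"
        by (rule sin_double_Suc_diff)
      then have "cot (t / 2) * sin (2 * real (Suc y) * t) - cot (t / 2) * sin (2 * real y * t) =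
          2 * (cot (t / 2) * sin t) * cos (real (2 * y + 1) * t)"
        by (simp add: right_diff_distrib[symmetric])
      also have "\<dots> = 2 * cos (real (2 * y + 1) * t) + 2 * cos t * cos (real (2 * y + 1) * t)"
        unfolding cot by (simp only: distrib_left distrib_right mult_1_right mult.commute)
      also have "2 * cos t * cos (real (2 * y + 1) * t) =
          cos (real (2 * y + 2) * t) + cos (real (2 * y) * t)"
      proof -
        have "real (2 * y + 1) * t + t = real (2 * y + 2) * t"
          "real (2 * y + 1) * t - t = real (2 * y) * t"
          by (simp_all add: algebra_simps)
        then show ?thesis
          using cos_times_cos[of "real (2 * y + 1) * t" t] by (simp add: mult_ac add.commute del: of_nat_add of_nat_mult)
      qed
      finally show ?thesis
        unfolding t_def by linarith
    qed
    then show ?thesis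
      by (simp add: D_def A_def sum.distrib sum_distrib_left del: of_nat_Suc of_nat_add of_nat_mult)
  qed
  have D: "D y = real n / 2" if "0 < y" "y \<le> N" for y
    using that
  proof (induction y rule: nat_induct_non_zero)
    case 1
    have "A 2 = - 1 / 2" "A 1 = 1 / 2"
      using 1 n by (subst A; auto dest!: dvd_imp_le)+
    moreover have "D 0 = 0"
      by (simp add: D_def)
    ultimately have "D (Suc 0) = 1 - 1 / 2 + real N"
      using step[of 0] A0 by (simp add: numeral_2_eq_2)
    then show ?case
      using n by simp
  next
    case (Suc y)
    have "A (2 * y + 1) = 1 / 2" "A (2 * y + 2) = - 1 / 2" "A (2 * y) = - 1 / 2"
      using Suc n by (subst A; auto dest!: dvd_imp_le)+
    then show ?case
      using step[of y] Suc by simp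
  qed
  have "D y = (if 2 * y < n then real n / 2 else - real n / 2)"
  proof (cases "2 * y < n")
    case True
    then show ?thesis using D[of y] y n by simp
  next
    case False
    have "sin (2 * real (n - y) * \<theta> j) = - sin (2 * real y * \<theta> j)" for j
    proof -
      have "real n * \<theta> j = real (2 * j + 1) * pi"
        using n by (simp add: \<theta>_def)
      then have "2 * real (n - y) * \<theta> j = 2 * real (2 * j + 1) * pi - 2 * real y * \<theta> j"
        using y by (simp add: of_nat_diff left_diff_distrib right_diff_distrib mult.assoc)
      moreover have "sin (2 * real (2 * j + 1) * pi) = 0" "cos (2 * real (2 * j + 1) * pi) = 1"
        using sin_npi[of "2 * (2 * j + 1)"] cos_npi[of "2 * (2 * j + 1)"] by simp_all
      ultimately show ?thesis
        by (simp add: sin_diff del: of_nat_add of_nat_mult)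
    qed
    then have "D (n - y) = - D y"
      by (simp add: D_def sum_negf)
    moreover have "D (n - y) = real n / 2"
      using D[of "n - y"] False y n by simp
    ultimately show ?thesis
      using False by simp
  qed
  then show ?thesis
    by (simp add: D_def \<theta>_def)
qed

text \<open>This is the finite Fourier expansion of the wave. Multiples of n are excluded because
  every sine vanishes there, while the wave has the value 1.\<close>

lemma square_wave_sine_expansion:
  assumes "odd n" "\<not> n dvd y"
  shows "(\<Sum>l | l < n \<and> odd l. cot (pi * real l / (2 * real n)) * sin (2 * pi * real l * real y / real n)) =
    real n / 2 * square_wave n y"
proof -
  obtain N where n: "n = 2 * N + 1"
    using assms(1) by (elim oddE)
  define z where "z = y mod n"
  have z: "0 < z" "z < n"
    using assms(2) n unfolding z_def dvd_eq_mod_eq_0 by simp_all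
  have "(\<Sum>l | l < n \<and> odd l. cot (pi * real l / (2 * real n)) * sin (2 * pi * real l * real y / real n)) =
      (\<Sum>j<N. cot (real (2 * j + 1) * pi / real n / 2) * sin (2 * real z * (real (2 * j + 1) * pi / real n)))"
  proof (rule sum.reindex_bij_witness[of _ "\<lambda>j. 2 * j + 1" "\<lambda>l. l div 2"])
    fix l assume "l \<in> {l. l < n \<and> odd l}"
    then have "odd l" "l < 2 * N + 1"
      using n by simp_all
    moreover from \<open>odd l\<close> obtain j where "l = 2 * j + 1"
      by (elim oddE)
    ultimately show l: "2 * (l div 2) + 1 = l" and "l div 2 \<in> {..<N}"
      by simp_all
    have "Im (unity n (int y * int l)) = Im (unity n (int z * int l))"
      by (rule arg_cong[OF unity_cong]) (use n in \<open>auto simp: z_def cong_def zmod_int mod_mult_left_eq\<close>)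
    then show "cot (real (2 * (l div 2) + 1) * pi / real n / 2) *
          sin (2 * real z * (real (2 * (l div 2) + 1) * pi / real n)) =
        cot (pi * real l / (2 * real n)) * sin (2 * pi * real l * real y / real n)"
      unfolding l by (simp add: unity_def mult_ac)
  qed (use n in auto)
  then show ?thesis
    using sum_cot_sin_odd_frequencies[OF n z] by (simp add: square_wave_def z_def)
qed

section \<open>Sums over units twisted by the square wave\<close>

lemma square_wave_mod [simp]: "square_wave n (x mod n) = square_wave n x"
  by (simp add: square_wave_def)

definition twisted_sum :: "nat \<Rightarrow> int \<Rightarrow> real" where
  "twisted_sum n b = (\<Sum>x\<in>units_below n. sin (2 * pi * of_int (b * int x) / real n) * square_wave n x)"

text \<open>The expansion applies to every unit, as 0 is not a unit for n > 1. The product of two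
  sines becomes a difference of cosines, and a sum of cosines over the units is the real part of a
  Ramanujan sum.\<close>

lemma twisted_sum_eq:
  assumes "odd n" "n > 1"
  shows "real n * twisted_sum n b = (\<Sum>l | l < n \<and> odd l. cot (pi * real l / (2 * real n)) *
    Re (ramanujan_sum n (b - int l) - ramanujan_sum n (b + int l)))"
proof -
  define e where "e k = 2 * pi * real_of_int k / real n" for k
  define c where "c l = cot (pi * real l / (2 * real n))" for l
  have Re: "Re (ramanujan_sum n k) = (\<Sum>x\<in>units_below n. cos (e (int x * k)))" for k
    by (simp add: ramanujan_sum_def unity_def e_def)
  have "real n * twisted_sum n b =
      (\<Sum>x\<in>units_below n. 2 * sin (e (b * int x)) * (real n / 2 * square_wave n x))"
    by (simp add: twisted_sum_def e_def sum_distrib_left mult_ac)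
  also have "\<dots> = (\<Sum>x\<in>units_below n. \<Sum>l | l < n \<and> odd l.
      c l * (cos (e (int x * (b - int l))) - cos (e (int x * (b + int l)))))"
  proof (rule sum.cong[OF refl])
    fix x assume x: "x \<in> units_below n"
    have "\<not> n dvd x"
      using x assms(2) by (auto simp: units_below_def)
    then have "real n / 2 * square_wave n x = (\<Sum>l | l < n \<and> odd l. c l * sin (e (int l * int x)))"
      using square_wave_sine_expansion[OF assms(1), of x] by (simp add: c_def e_def mult.assoc)
    moreover have "2 * sin (e (b * int x)) * (c l * sin (e (int l * int x))) =
        c l * (cos (e (int x * (b - int l))) - cos (e (int x * (b + int l))))" for l
    proof -
      have "e (int x * (b - int l)) = e (b * int x) - e (int l * int x)"
        "e (int x * (b + int l)) = e (b * int x) + e (int l * int x)"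
        by (simp_all add: e_def diff_divide_distrib add_divide_distrib algebra_simps)
      then show ?thesis
        by (simp only: cos_diff cos_add) (simp add: algebra_simps)
    qed
    ultimately show "2 * sin (e (b * int x)) * (real n / 2 * square_wave n x) =
        (\<Sum>l | l < n \<and> odd l. c l * (cos (e (int x * (b - int l))) - cos (e (int x * (b + int l)))))"
      by (simp only: sum_distrib_left)
  qed
  also have "\<dots> = (\<Sum>l | l < n \<and> odd l. c l * Re (ramanujan_sum n (b - int l) - ramanujan_sum n (b + int l)))"
    by (subst sum.swap) (simp add: Re sum_subtractf sum_distrib_left right_diff_distrib)
  finally show ?thesis
    by (simp add: c_def)
qed

section \<open>Bounds for the cotangent and for sums of reciprocals\<close>

lemma cot_bounds:
  fixes x :: real
  assumes "0 < x" "x < pi / 2"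
  shows "0 \<le> cot x" "x * cot x \<le> 1" "1 - x\<^sup>2 / 2 \<le> x * cot x"
proof -
  have pos: "0 < sin x" "0 < cos x"
    using assms by (auto intro: sin_gt_zero cos_gt_zero)
  then show "0 \<le> cot x"
    by (simp add: cot_def)
  have "sin 0 - 0 * cos 0 \<le> sin x - x * cos x"
  proof (rule DERIV_nonneg_imp_nondecreasing[of 0 x "\<lambda>t. sin t - t * cos t"])
    fix t assume "0 \<le> t" "t \<le> x"
    then have "0 \<le> t * sin t"
      using assms by (intro mult_nonneg_nonneg sin_ge_zero) auto
    moreover have "((\<lambda>t. sin t - t * cos t) has_real_derivative t * sin t) (at t)"
      by (auto intro!: derivative_eq_intros)
    ultimately show "\<exists>y. ((\<lambda>t. sin t - t * cos t) has_real_derivative y) (at t) \<and> 0 \<le> y"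
      by blast
  qed (use assms in simp)
  then show "x * cot x \<le> 1"
    using pos by (simp add: cot_def field_simps)
  have "(sin (x / 2))\<^sup>2 \<le> (x / 2)\<^sup>2"
    using assms by (intro power_mono sin_x_le_x sin_ge_zero) auto
  then have "1 - x\<^sup>2 / 2 \<le> cos x"
    using cos_double_sin[of "x / 2"] by (simp add: power2_eq_square)
  also have "\<dots> \<le> x * cot x"
    using pos sin_x_le_x[of x] assms by (simp add: cot_def field_simps)
  finally show "1 - x\<^sup>2 / 2 \<le> x * cot x" .
qed

lemma sum_inverse_le_ln:
  assumes "n > 0"
  shows "(\<Sum>k=1..n. 1 / real k) \<le> 1 + ln (real n)"
  using assms
proof (induction n rule: nat_induct_non_zero)
  case (Suc n)
  have "ln (real n / real (Suc n)) \<le> real n / real (Suc n) - 1"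
    using Suc by (intro ln_le_minus_one) simp
  moreover have "ln (real n / real (Suc n)) = ln (real n) - ln (real (Suc n))"
    using Suc by (intro ln_divide_pos) auto
  moreover have "real n / real (Suc n) - 1 = - (1 / real (Suc n))"
    by (simp add: field_simps)
  ultimately show ?case
    using Suc by (simp del: of_nat_Suc)
qed simp

text \<open>The map from m to the integer part of m / \<delta> is injective by the separation and
  takes values from 1 to N, so the sum is dominated by a harmonic sum.\<close>

lemma sum_inverse_separated_pos:
  fixes X :: "int set" and \<delta> :: real
  assumes "finite X" "\<delta> > 0"
    and bounds: "\<And>m. m \<in> X \<Longrightarrow> \<delta> \<le> of_int m \<and> of_int m \<le> \<delta> * real N"
    and sep: "\<And>m m'. m \<in> X \<Longrightarrow> m' \<in> X \<Longrightarrow> m \<noteq> m' \<Longrightarrow> \<delta> \<le> \<bar>of_int (m - m')\<bar>"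
  shows "(\<Sum>m\<in>X. 1 / of_int m) \<le> (\<Sum>k=1..N. 1 / real k) / \<delta>"
proof -
  define k where "k m = nat \<lfloor>of_int m / \<delta>\<rfloor>" for m :: int
  have k: "real (k m) \<le> of_int m / \<delta>" "of_int m / \<delta> < real (k m) + 1" "1 \<le> k m" "k m \<le> N"
    if "m \<in> X" for m
  proof -
    have "1 \<le> of_int m / \<delta>" "of_int m / \<delta> \<le> real N"
      using bounds[OF that] assms(2) by (auto simp: field_simps)
    moreover then have "1 \<le> \<lfloor>of_int m / \<delta>\<rfloor>" "\<lfloor>of_int m / \<delta>\<rfloor> \<le> int N"
      by linarith+
    ultimately show "real (k m) \<le> of_int m / \<delta>" "of_int m / \<delta> < real (k m) + 1" "1 \<le> k m" "k m \<le> N"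
      unfolding k_def by linarith+
  qed
  have inj: "inj_on k X"
  proof (rule inj_onI, rule ccontr)
    fix m m' assume m: "m \<in> X" "m' \<in> X" "k m = k m'" "m \<noteq> m'"
    have "\<bar>of_int m / \<delta> - of_int m' / \<delta>\<bar> < 1"
      using k(1,2)[OF m(1)] k(1,2)[OF m(2)] m(3) by linarith
    then have "\<bar>of_int (m - m')\<bar> < \<delta>"
      using assms(2) by (simp add: diff_divide_distrib[symmetric] abs_divide)
    with sep[OF m(1,2,4)] show False by simp
  qed
  have "(\<Sum>m\<in>X. 1 / of_int m) \<le> (\<Sum>m\<in>X. 1 / (\<delta> * real (k m)))"
  proof (rule sum_mono)
    fix m assume m: "m \<in> X"
    have "\<delta> * real (k m) \<le> of_int m" "0 < \<delta> * real (k m)"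
      using k[OF m] assms(2) by (auto simp: field_simps)
    then show "1 / of_int m \<le> 1 / (\<delta> * real (k m))"
      by (intro frac_le) auto
  qed
  also have "\<dots> = (\<Sum>i\<in>k ` X. 1 / (\<delta> * real i))"
    using inj by (simp add: sum.reindex)
  also have "\<dots> \<le> (\<Sum>i=1..N. 1 / (\<delta> * real i))"
    using k assms(2) by (intro sum_mono2) auto
  also have "\<dots> = (\<Sum>k=1..N. 1 / real k) / \<delta>"
    by (simp add: sum_divide_distrib mult.commute)
  finally show ?thesis .
qed

text \<open>Positive and negative members are treated separately. The bound serves for all
  frequencies with \<delta> = 1 and for the resonances with \<delta> = sqrt n / 2.\<close>

lemma sum_inverse_separated:
  fixes X :: "int set" and \<delta> :: real
  assumes "finite X" "\<delta> > 0"
    and bounds: "\<And>m. m \<in> X \<Longrightarrow> \<delta> \<le> of_int \<bar>m\<bar> \<and> of_int \<bar>m\<bar> \<le> \<delta> * real N"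
    and sep: "\<And>m m'. m \<in> X \<Longrightarrow> m' \<in> X \<Longrightarrow> m \<noteq> m' \<Longrightarrow> \<delta> \<le> \<bar>of_int (m - m')\<bar>"
  shows "(\<Sum>m\<in>X. 1 / of_int \<bar>m\<bar>) \<le> 2 * (\<Sum>k=1..N. 1 / real k) / \<delta>"
proof -
  let ?P = "{m \<in> X. m > 0}" and ?Q = "{m \<in> X. \<not> m > 0}"
  have "(\<Sum>m\<in>X. 1 / real_of_int \<bar>m\<bar>) = (\<Sum>m\<in>?P \<union> ?Q. 1 / real_of_int \<bar>m\<bar>)"
    by (rule sum.cong) auto
  also have "\<dots> = (\<Sum>m\<in>?P. 1 / real_of_int \<bar>m\<bar>) + (\<Sum>m\<in>?Q. 1 / real_of_int \<bar>m\<bar>)"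
    using assms(1) by (intro sum.union_disjoint) auto
  also have "(\<Sum>m\<in>?P. 1 / real_of_int \<bar>m\<bar>) = (\<Sum>m\<in>?P. 1 / real_of_int m)"
    by (rule sum.cong) auto
  also have "(\<Sum>m\<in>?Q. 1 / real_of_int \<bar>m\<bar>) = (\<Sum>m\<in>uminus ` ?Q. 1 / real_of_int m)"
    by (subst sum.reindex) (auto intro!: sum.cong)
  also have "(\<Sum>m\<in>?P. 1 / real_of_int m) \<le> (\<Sum>k=1..N. 1 / real k) / \<delta>"
    using assms by (intro sum_inverse_separated_pos) force+
  also have "(\<Sum>m\<in>uminus ` ?Q. 1 / real_of_int m) \<le> (\<Sum>k=1..N. 1 / real k) / \<delta>"
  proof (rule sum_inverse_separated_pos)
    fix m assume "m \<in> uminus ` ?Q"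
    then show "\<delta> \<le> real_of_int m \<and> real_of_int m \<le> \<delta> * real N"
      using bounds[of "- m"] by auto
  next
    fix m m' assume "m \<in> uminus ` ?Q" "m' \<in> uminus ` ?Q" "m \<noteq> m'"
    then show "\<delta> \<le> \<bar>of_int (m - m')\<bar>"
      using sep[of "- m" "- m'"] by auto
  qed (use assms in auto)
  finally show ?thesis
    by simp
qed

section \<open>Twisted sums as sums over odd frequencies of both signs\<close>

definition odd_window :: "nat \<Rightarrow> int set" where
  "odd_window n = {m. odd m \<and> \<bar>m\<bar> < int n}"

lemma finite_odd_window [simp]: "finite (odd_window n)"
  by (rule finite_subset[of _ "{- int n..int n}"]) (auto simp: odd_window_def)

lemma odd_windowD:
  assumes "m \<in> odd_window n"
  shows "\<bar>m\<bar> \<ge> 1" "\<bar>m\<bar> < int n" "odd m"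
proof -
  show "\<bar>m\<bar> < int n" "odd m"
    using assms by (auto simp: odd_window_def)
  then have "m \<noteq> 0"
    by auto
  then show "\<bar>m\<bar> \<ge> 1"
    by linarith
qed

text \<open>The factor makes the coefficient close to 1 / m when m is small compared with n, as in
  the classical Fourier series of the square wave.\<close>

definition wave_coeff :: "nat \<Rightarrow> int \<Rightarrow> real" where
  "wave_coeff n m = pi / (2 * real n) * cot (pi * of_int m / (2 * real n))"

definition ramanujan_weight :: "nat \<Rightarrow> int \<Rightarrow> real" where
  "ramanujan_weight n m = Re (ramanujan_sum n m) / real (totient n)"

lemma cot_uminus: "cot (- x) = - cot (x :: real)"
  by (simp add: cot_def)

lemma wave_coeff_uminus: "wave_coeff n (- m) = - wave_coeff n m"
  by (simp add: wave_coeff_def cot_uminus)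

text \<open>Since the coefficients are odd in m, the terms with \<open>b + int l\<close> are those
  of the negative frequencies. The left-hand side is the quantity T b of the overview.\<close>

lemma twisted_sum_window:
  assumes "odd n" "n > 1"
  shows "pi / 2 * twisted_sum n b / real (totient n) =
    (\<Sum>m\<in>odd_window n. wave_coeff n m * ramanujan_weight n (b - m))"
proof -
  let ?O = "{l. l < n \<and> odd l}" and ?f = "\<lambda>m. wave_coeff n m * ramanujan_weight n (b - m)"
  have "finite ?O" by simp
  have "odd_window n = int ` ?O \<union> (\<lambda>l. - int l) ` ?O" (is "_ = ?A \<union> ?B")
  proof (intro equalityI subsetI)
    fix m assume m: "m \<in> odd_window n"
    then have "nat \<bar>m\<bar> \<in> ?O"
      by (auto simp: odd_window_def even_nat_iff)
    moreover have "m = int (nat \<bar>m\<bar>) \<or> m = - int (nat \<bar>m\<bar>)"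
      by linarith
    ultimately show "m \<in> ?A \<union> ?B"
      by blast
  qed (auto simp: odd_window_def)
  moreover have "?A \<inter> ?B = {}"
    by (auto dest: odd_pos)
  ultimately have "sum ?f (odd_window n) = sum ?f ?A + sum ?f ?B"
    using \<open>finite ?O\<close> by (simp add: sum.union_disjoint)
  also have "sum ?f ?A = (\<Sum>l\<in>?O. wave_coeff n (int l) * ramanujan_weight n (b - int l))"
    by (subst sum.reindex) auto
  also have "sum ?f ?B = (\<Sum>l\<in>?O. - wave_coeff n (int l) * ramanujan_weight n (b + int l))"
    by (subst sum.reindex) (auto simp: inj_on_def wave_coeff_uminus)
  finally have "sum ?f (odd_window n) =
      (\<Sum>l\<in>?O. wave_coeff n (int l) * (ramanujan_weight n (b - int l) - ramanujan_weight n (b + int l)))"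
    by (simp add: sum.distrib[symmetric] right_diff_distrib)
  also have "\<dots> = (\<Sum>l\<in>?O. pi / (2 * real n * real (totient n)) * (cot (pi * real l / (2 * real n)) *
    Re (ramanujan_sum n (b - int l) - ramanujan_sum n (b + int l))))"
    by (rule sum.cong[OF refl]) (simp add: wave_coeff_def ramanujan_weight_def diff_divide_distrib[symmetric])
  also have "\<dots> = pi / (2 * real n * real (totient n)) * (real n * twisted_sum n b)"
    unfolding twisted_sum_eq[OF assms] by (rule sum_distrib_left[symmetric])
  finally show ?thesis
    using assms by simp
qed

lemma wave_coeff_bounds:
  assumes "0 < m" "m < int n"
  shows "0 \<le> wave_coeff n m" "wave_coeff n m \<le> 1 / of_int m"
    "1 - (pi * of_int m / (2 * real n))\<^sup>2 / 2 \<le> of_int m * wave_coeff n m"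
proof -
  define x where "x = pi * of_int m / (2 * real n)"
  have n: "real n > 0" "real_of_int m < real n"
    using assms by linarith+
  have "pi * of_int m < pi * real n"
    using n by (intro mult_strict_left_mono) auto
  then have x: "0 < x" "x < pi / 2"
    using assms n by (auto simp: x_def field_simps)
  have eq: "of_int m * wave_coeff n m = x * cot x"
    by (simp add: wave_coeff_def x_def)
  show "0 \<le> wave_coeff n m"
    using cot_bounds(1)[OF x] by (simp add: wave_coeff_def x_def)
  show "wave_coeff n m \<le> 1 / of_int m"
    using cot_bounds(2)[OF x] assms eq by (simp add: field_simps)
  show "1 - (pi * of_int m / (2 * real n))\<^sup>2 / 2 \<le> of_int m * wave_coeff n m"
    using cot_bounds(3)[OF x] eq by (simp add: x_def)
qed

lemma abs_wave_coeff_le: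
  assumes "m \<in> odd_window n"
  shows "\<bar>wave_coeff n m\<bar> \<le> 1 / of_int \<bar>m\<bar>"
proof (cases "m > 0")
  case True
  then show ?thesis
    using assms wave_coeff_bounds[of m n] by (simp add: odd_window_def)
next
  case False
  have "m \<noteq> 0" using assms by (auto simp: odd_window_def)
  then show ?thesis
    using False assms wave_coeff_bounds[of "- m" n] by (simp add: odd_window_def wave_coeff_uminus)
qed

section \<open>Size of the Ramanujan weights and spacing of the resonances\<close>

lemma reduced_denominator_mult_gcd:
  "n = reduced_denominator n m * nat (gcd (int n) m)"
proof -
  have "nat (gcd (int n) m) dvd n"
    by (metis gcd_dvd1 int_dvd_int_iff int_nat_eq gcd_ge_0_int)
  then show ?thesis by (simp add: reduced_denominator_def)
qed

lemma reduced_denominator_pos: "n > 0 \<Longrightarrow> reduced_denominator n m > 0"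
  using reduced_denominator_mult_gcd[of n m] by (metis gr0I mult_0)

lemma reduced_denominator_eq_1_iff:
  assumes "n > 0"
  shows "reduced_denominator n m = 1 \<longleftrightarrow> int n dvd m"
proof
  assume "reduced_denominator n m = 1"
  then have "n = nat (gcd (int n) m)"
    using reduced_denominator_mult_gcd[of n m] by simp
  then have "int n = gcd (int n) m"
    by (metis gcd_ge_0_int int_nat_eq)
  then show "int n dvd m"
    by (metis gcd_dvd2)
next
  assume "int n dvd m"
  then show "reduced_denominator n m = 1"
    using assms by (simp add: reduced_denominator_def gcd_proj1_iff)
qed

lemma abs_ramanujan_weight_le:
  assumes "n > 0"
  shows "\<bar>ramanujan_weight n m\<bar> \<le> 1 / real (totient (reduced_denominator n m))"
proof -
  have "real (totient n) > 0" "real (totient (reduced_denominator n m)) > 0"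
    using assms reduced_denominator_pos by auto
  moreover have "\<bar>Re (ramanujan_sum n m)\<bar> * totient (reduced_denominator n m) \<le> totient n"
    using norm_ramanujan_sum_le[OF assms, of m] abs_Re_le_cmod[of "ramanujan_sum n m"]
    by (meson mult_right_mono of_nat_0_le_iff order_trans)
  ultimately show ?thesis
    by (simp add: ramanujan_weight_def field_simps)
qed

lemma ramanujan_weight_eq_1:
  assumes "n > 0" "int n dvd m"
  shows "ramanujan_weight n m = 1"
proof -
  have "ramanujan_sum n m = of_nat (totient n)"
  proof -
    have "unity n (int x * m) = 1" for x
      using assms by (simp add: unity_eq_1_iff)
    then show ?thesis
      using assms(1) by (simp add: ramanujan_sum_def card_units_below)
  qed
  then show ?thesis
    using assms(1) by (simp add: ramanujan_weight_def)
qed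

text \<open>
  A frequency \<open>m\<close> contributes noticeably only if \<open>b - m\<close> has a large common factor with \<open>n\<close>. Two such
  factors have a large common factor themselves, and it divides the difference of the frequencies.
\<close>

definition resonances :: "nat \<Rightarrow> int \<Rightarrow> int set" where
  "resonances n b = {m \<in> odd_window n. totient (reduced_denominator n (b - m)) ^ 5 < n}"

lemma coprime_reduced_denominator:
  assumes "coprime n k"
  shows "coprime (reduced_denominator n m) k"
  using assms reduced_denominator_mult_gcd[of n m] by (metis coprime_mult_left_iff)

text \<open>The totient bound gives d^4 < n and d'^4 < n, hence (d d')^2 < n. As g g' = n^2 / (d d')
  and the lcm of g and g' is at most n, their gcd is at least n / (d d'), which exceeds sqrt
  n.\<close>

lemma resonances_separated:
  assumes "coprime n 6" and m: "m \<in> resonances n b" "m' \<in> resonances n b" "m \<noteq> m'"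
  shows "sqrt (real n) < of_int \<bar>m - m'\<bar>"
proof -
  define g g' where "g = nat (gcd (int n) (b - m))" and "g' = nat (gcd (int n) (b - m'))"
  define d d' where "d = reduced_denominator n (b - m)" and "d' = reduced_denominator n (b - m')"
  have n: "n = d * g" "n = d' * g'"
    unfolding d_def g_def d'_def g'_def by (rule reduced_denominator_mult_gcd)+
  have npos: "n > 0"
    using m(1) by (auto simp: resonances_def)
  have "d ^ 4 < n" "d' ^ 4 < n"
    using m(1,2) totient_power_lower_bound[OF coprime_reduced_denominator[OF assms(1)]]
    unfolding resonances_def d_def d'_def by (auto intro: le_less_trans)
  then have "d ^ 4 * d' ^ 4 < n * n"
    by (intro mult_strict_mono) auto
  then have "((d * d') ^ 2) ^ 2 < n ^ 2"
    by (simp add: power_mult_distrib power2_eq_square power4_eq_xxxx mult_ac)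
  then have dd: "(d * d') ^ 2 < n"
    using power_less_imp_less_base by blast
  have "lcm g g' \<le> n"
    using n npos by (metis dvd_imp_le dvd_triv_right lcm_least)
  then have "n * n \<le> d * d' * gcd g g' * n"
  proof -
    have "n * n = d * d' * (gcd g g' * lcm g g')"
      using n by (metis prod_gcd_lcm_nat mult.assoc mult.left_commute)
    also have "\<dots> \<le> d * d' * (gcd g g' * n)"
      using \<open>lcm g g' \<le> n\<close> by (intro mult_left_mono) auto
    finally show ?thesis by (simp add: mult.assoc)
  qed
  then have "n \<le> d * d' * gcd g g'"
    using npos by simp
  then have "n ^ 2 \<le> (d * d') ^ 2 * (gcd g g') ^ 2"
    by (metis power_mono power_mult_distrib zero_le)
  also have "\<dots> < n * (gcd g g') ^ 2"
  proof -
    have "gcd g g' > 0" using npos n by (auto intro!: Nat.gr0I)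
    then show ?thesis using dd by (intro mult_strict_right_mono) auto
  qed
  finally have "n < (gcd g g') ^ 2"
    using npos by (simp add: power2_eq_square)
  then have "sqrt (real n) < real (gcd g g')"
    by (metis of_nat_0_le_iff of_nat_less_iff of_nat_power real_sqrt_less_mono real_sqrt_abs2 real_sqrt_unique)
  moreover have "int (gcd g g') dvd m - m'"
  proof -
    have "int g dvd b - m" "int g' dvd b - m'"
      by (simp_all add: g_def g'_def)
    moreover have "int (gcd g g') dvd int g" "int (gcd g g') dvd int g'"
      by (simp_all only: int_dvd_int_iff gcd_dvd1 gcd_dvd2)
    ultimately have "int (gcd g g') dvd b - m'" "int (gcd g g') dvd b - m"
      using dvd_trans by blast+
    then have "int (gcd g g') dvd (b - m') - (b - m)"
      by (rule dvd_diff)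
    then show ?thesis by simp
  qed
  then have "int (gcd g g') \<le> \<bar>m - m'\<bar>"
    using m(3) dvd_imp_le_int[of "m - m'" "int (gcd g g')"] by simp
  ultimately show ?thesis
    by linarith
qed

section \<open>Isolating the main term and bounding it from below\<close>

lemma resonance_error_numeric:
  assumes "n > 10 ^ 20"
  shows "2 * (1 + ln (real n)) / root 5 (real n) + 4 * (1 + ln (real n)) / sqrt (real n) \<le> 1 / 60"
proof -
  \<comment> \<open>The twentieth root turns the hypothesis on n into r >= 10 and both denominators
    into powers of r.\<close>
  define r where "r = root 20 (real n)"
  have rn: "r ^ 20 = real n"
    unfolding r_def using assms by (intro real_root_pow_pos2) auto
  have "10 ^ 20 < real n"
    using assms by (metis of_nat_less_iff of_nat_numeral of_nat_power)
  then have r: "r \<ge> 10"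
    unfolding rn[symmetric] by (metis less_imp_le linorder_not_le power_mono r_def real_root_ge_zero of_nat_0_le_iff not_less)
  \<comment> \<open>The tangent of ln at 4 gives ln r <= r / 4 + 1. Then 1 + 20 ln r <= 5 r + 21,
    which is at most 36/5 r for r >= 10.\<close>
  have "ln (r / 4) \<le> r / 4 - 1"
    using r by (intro ln_le_minus_one) auto
  moreover have "ln (r / 4) = ln r - ln (2 * 2)"
    using r by (subst ln_divide_pos) auto
  moreover have "ln (2 * 2 :: real) = 2 * ln 2"
    by (subst ln_mult) auto
  moreover have "ln (2::real) \<le> 1"
    using ln_le_minus_one[of "2::real"] by simp
  ultimately have "ln r \<le> r / 4 + 1"
    by simp
  moreover have "ln (real n) = 20 * ln r"
    unfolding rn[symmetric] using r by (simp add: ln_realpow)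
  ultimately have H: "1 + ln (real n) \<le> 36 / 5 * r"
    using r by simp
  have roots: "root 5 (real n) = r ^ 4" "sqrt (real n) = r ^ 10"
    unfolding rn[symmetric] using r
    by (auto intro!: real_root_pos_unique real_sqrt_unique simp: power_mult[symmetric])
  have "2 * (1 + ln (real n)) / r ^ 4 \<le> 2 * (36 / 5 * r) / r ^ 4"
    using H r by (intro divide_right_mono) auto
  also have "\<dots> = 72 / 5 / r ^ 3"
    using r by (simp add: power_eq_if)
  also have "\<dots> \<le> 72 / 5 / 10 ^ 3"
    using r by (intro divide_left_mono power_mono mult_pos_pos) auto
  finally have 1: "2 * (1 + ln (real n)) / r ^ 4 \<le> 72 / 5 / 10 ^ 3" .
  have "4 * (1 + ln (real n)) / r ^ 10 \<le> 4 * (36 / 5 * r) / r ^ 10"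
    using H r by (intro divide_right_mono) auto
  also have "\<dots> = 144 / 5 / r ^ 9"
    using r by (simp add: power_eq_if)
  also have "\<dots> \<le> 144 / 5 / 10 ^ 9"
    using r by (intro divide_left_mono power_mono mult_pos_pos) auto
  finally have "4 * (1 + ln (real n)) / r ^ 10 \<le> 144 / 5 / 10 ^ 9" .
  from add_mono[OF 1 this] show ?thesis
    unfolding roots by (rule order_trans) simp
qed


lemma resonance_unique:
  assumes "coprime n 6" "m \<in> resonances n b" "m' \<in> resonances n b"
    "2 * of_int \<bar>m\<bar> < sqrt (real n)" "2 * of_int \<bar>m'\<bar> < sqrt (real n)"
  shows "m = m'"
proof (rule ccontr)
  assume "m \<noteq> m'"
  then have "sqrt (real n) < of_int \<bar>m - m'\<bar>"
    using resonances_separated assms by blast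
  also have "of_int \<bar>m - m'\<bar> \<le> real_of_int \<bar>m\<bar> + of_int \<bar>m'\<bar>"
    by linarith
  finally show False
    using assms(4,5) by linarith
qed

text \<open>At most one resonance lies within sqrt n / 2 of 0, and it is taken as m0. Among the
  remaining terms, those outside the resonances carry a weight of at most n^(-1/5) and add up to at
  most 2 H / n^(1/5), where H is the harmonic sum. The other resonances are large and widely spaced,
  and add up to at most 4 H / sqrt n.\<close>

lemma wave_sum_main_term:
  assumes n: "n > 10 ^ 20" "coprime n 6"
  obtains m0 where "m0 \<in> odd_window n"
    "\<forall>m\<in>resonances n b. 2 * of_int \<bar>m\<bar> < sqrt (real n) \<longrightarrow> m = m0"
    "\<bar>(\<Sum>m\<in>odd_window n. wave_coeff n m * ramanujan_weight n (b - m)) -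
       wave_coeff n m0 * ramanujan_weight n (b - m0)\<bar> \<le> 1 / 60"
proof -
  obtain m0 where m0: "m0 \<in> odd_window n"
      "\<And>m. m \<in> resonances n b \<Longrightarrow> 2 * of_int \<bar>m\<bar> < sqrt (real n) \<Longrightarrow> m = m0"
  proof (cases "\<exists>m\<in>resonances n b. 2 * of_int \<bar>m\<bar> < sqrt (real n)")
    case True
    then show ?thesis
      using that resonance_unique[OF n(2)] by (metis (no_types, lifting) mem_Collect_eq resonances_def)
  next
    case False
    then show ?thesis
      \<comment> \<open>Without a small resonance the condition on m0 is vacuous, and 1 is an
        arbitrary member of the window.\<close>
      using that[of 1] n(1) by (auto simp: odd_window_def)
  qed
  let ?t = "\<lambda>m. wave_coeff n m * ramanujan_weight n (b - m)"
  let ?W = "odd_window n" and ?R = "resonances n b"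
  define H where "H = (\<Sum>k=1..n. 1 / real k)"
  define q where "q = root 5 (real n)"
  have npos: "n > 0" and q: "q > 0" "q ^ 5 = real n"
    using n(1) by (auto simp: q_def)
  have RW: "?R \<subseteq> ?W"
    by (auto simp: resonances_def)
  then have fin: "finite ?R"
    using finite_subset finite_odd_window by blast
  have nz: "\<bar>m\<bar> \<ge> 1" "\<bar>m\<bar> < int n" if "m \<in> ?W" for m
    using odd_windowD[OF that] by auto
  have t: "\<bar>?t m\<bar> \<le> 1 / of_int \<bar>m\<bar> * (1 / real (totient (reduced_denominator n (b - m))))"
    if "m \<in> ?W" for m
    unfolding abs_mult using that npos
    by (intro mult_mono abs_wave_coeff_le abs_ramanujan_weight_le) auto
  have far: "\<bar>?t m\<bar> \<le> 1 / of_int \<bar>m\<bar> / q" if m: "m \<in> ?W - ?R" for m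
  proof -
    define \<phi> where "\<phi> = totient (reduced_denominator n (b - m))"
    have "n \<le> \<phi> ^ 5"
      using m by (auto simp: resonances_def \<phi>_def)
    then have "q ^ 5 \<le> real \<phi> ^ 5"
      unfolding q(2) by (metis of_nat_le_iff of_nat_power)
    then have "q \<le> real \<phi>"
      using power_le_imp_le_base[of q 4 "real \<phi>"] by simp
    then have "1 / of_int \<bar>m\<bar> * (1 / real \<phi>) \<le> 1 / of_int \<bar>m\<bar> * (1 / q)"
      using q(1) by (intro mult_left_mono divide_left_mono mult_pos_pos) auto
    with t[of m] m show ?thesis
      by (simp add: \<phi>_def)
  qed
  have near: "\<bar>?t m\<bar> \<le> 1 / of_int \<bar>m\<bar>" if m: "m \<in> ?R" for m
  proof -
    have "totient (reduced_denominator n (b - m)) \<ge> 1"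
      using reduced_denominator_pos[OF npos, of "b - m"] by (simp add: Suc_le_eq)
    then have "1 / real (totient (reduced_denominator n (b - m))) \<le> 1 / 1"
      by (intro frac_le) auto
    then have "1 / of_int \<bar>m\<bar> * (1 / real (totient (reduced_denominator n (b - m)))) \<le>
        1 / of_int \<bar>m\<bar> * 1"
      by (intro mult_left_mono) auto
    with t[of m] m RW show ?thesis
      by (metis mult_1_right order_trans subsetD)
  qed
  have "sum ?t ?W - ?t m0 = sum ?t (?W - {m0})"
    using m0(1) by (simp add: sum_diff1)
  also have "\<dots> = sum ?t (?W - ?R - {m0}) + sum ?t (?R - {m0})"
  proof -
    have "?W - {m0} = (?W - ?R - {m0}) \<union> (?R - {m0})"
      using RW by auto
    also have "sum ?t \<dots> = sum ?t (?W - ?R - {m0}) + sum ?t (?R - {m0})"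
      using fin by (intro sum.union_disjoint) auto
    finally show ?thesis .
  qed
  finally have "\<bar>sum ?t ?W - ?t m0\<bar> \<le> \<bar>sum ?t (?W - ?R - {m0})\<bar> + \<bar>sum ?t (?R - {m0})\<bar>"
    by simp
  also have "\<bar>sum ?t (?W - ?R - {m0})\<bar> \<le> (\<Sum>m\<in>?W - ?R - {m0}. 1 / of_int \<bar>m\<bar> / q)"
    using far by (intro order_trans[OF sum_abs] sum_mono) auto
  also have "\<dots> \<le> (\<Sum>m\<in>?W. 1 / of_int \<bar>m\<bar>) / q"
    unfolding sum_divide_distrib using q(1) by (intro sum_mono2) auto
  also have "(\<Sum>m\<in>?W. 1 / of_int \<bar>m\<bar>) \<le> 2 * H / 1"
    unfolding H_def
  proof (rule sum_inverse_separated)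
    fix m m' :: int assume "m \<noteq> m'"
    then show "1 \<le> \<bar>real_of_int (m - m')\<bar>"
      by linarith
  qed (use nz in \<open>force+\<close>)
  also have "\<bar>sum ?t (?R - {m0})\<bar> \<le> (\<Sum>m\<in>?R - {m0}. 1 / of_int \<bar>m\<bar>)"
    using near by (intro order_trans[OF sum_abs] sum_mono) auto
  \<comment> \<open>The spacing is sqrt n, but \<delta> must also bound the absolute values from
    below, and these are only known to be at least sqrt n / 2.\<close>
  also have "\<dots> \<le> 2 * H / (sqrt (real n) / 2)"
    unfolding H_def
  proof (rule sum_inverse_separated)
    fix m assume m: "m \<in> ?R - {m0}"
    have "real_of_int \<bar>m\<bar> \<le> 1 * real n"
      using nz(2)[of m] m RW by auto
    also have "\<dots> \<le> sqrt (real n) / 2 * real n"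
    proof -
      have "sqrt (2 * 2) \<le> sqrt (real n)"
        using n(1) by (intro real_sqrt_le_mono) simp
      then show ?thesis
        unfolding real_sqrt_abs2 by (intro mult_right_mono) auto
    qed
    finally show "sqrt (real n) / 2 \<le> of_int \<bar>m\<bar> \<and> of_int \<bar>m\<bar> \<le> sqrt (real n) / 2 * real n"
      using m0(2)[of m] m by force
  next
    fix m m' assume "m \<in> ?R - {m0}" "m' \<in> ?R - {m0}" "m \<noteq> m'"
    then have "sqrt (real n) < of_int \<bar>m - m'\<bar>"
      using resonances_separated[OF n(2)] by blast
    moreover have "sqrt (real n) / 2 \<le> sqrt (real n)"
      by simp
    ultimately show "sqrt (real n) / 2 \<le> \<bar>of_int (m - m')\<bar>"
      by linarith
  qed (use fin npos in auto)
  finally have "\<bar>sum ?t ?W - ?t m0\<bar> \<le> 2 * H / q + 4 * H / sqrt (real n)"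
    using q(1) by (simp add: divide_right_mono)
  also have "\<dots> \<le> 2 * (1 + ln (real n)) / q + 4 * (1 + ln (real n)) / sqrt (real n)"
    using sum_inverse_le_ln[OF npos] q(1) unfolding H_def
    by (intro add_mono divide_right_mono mult_left_mono) auto
  also have "\<dots> \<le> 1 / 60"
    using resonance_error_numeric[OF n(1)] by (simp add: q_def)
  finally show ?thesis
    using m0 by (intro that) blast+
qed

text \<open>
  The value \<open>-1/3\<close> arises from the frequency \<open>-3\<close>. A prime \<open>3\<close> dividing \<open>n\<close> would allow
  \<open>-1/2\<close> here.
\<close>

lemma resonant_term_ge:
  assumes n: "n > 10 ^ 20" "coprime n 6" and m: "m \<in> odd_window n"
    and b: "\<not> [b = - 1] (mod int n)"
  shows "wave_coeff n m * ramanujan_weight n (b - m) \<ge>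
    (if [b = - 3] (mod int n) then - 1 / 3 else - 1 / 4)"
proof -
  have npos: "n > 0"
    using n by simp
  note mz = odd_windowD[OF m]
  define d where "d = reduced_denominator n (b - m)"
  show ?thesis
  proof (cases "int n dvd b - m")
    case True
    \<comment> \<open>The weight is 1 and the term is the coefficient itself, which can be negative
      only for m < 0. As m is odd and -1 is excluded, the candidates are -3 and numbers up to
      -5.\<close>
    then have bm: "[b = m] (mod int n)" and w: "ramanujan_weight n (b - m) = 1"
      using ramanujan_weight_eq_1[OF npos] by (auto simp: cong_iff_dvd_diff)
    have "m \<noteq> - 2" "m \<noteq> - 4"
      using mz(3) by auto
    then consider "m > 0" | "m = - 1" | "m = - 3" | "m \<le> - 5"
      using mz(1) by linarith
    then show ?thesis
    proof cases
      case 1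
      then show ?thesis
        using wave_coeff_bounds(1)[of m n] mz w by simp
    next
      case 2
      then show ?thesis using b bm by simp
    next
      case 3
      then show ?thesis
        using abs_wave_coeff_le[OF m] bm w by (simp add: abs_le_iff)
    next
      case 4
      have "1 / real_of_int \<bar>m\<bar> \<le> 1 / 5"
        using 4 by (intro divide_left_mono) auto
      then show ?thesis
        using abs_wave_coeff_le[OF m] w by (simp add: abs_le_iff)
    qed
  next
    case False
    then have d: "d \<noteq> 1" "d > 0" "coprime d 6"
      using reduced_denominator_eq_1_iff[OF npos] reduced_denominator_pos[OF npos]
        coprime_reduced_denominator[OF n(2)] by (auto simp: d_def)
    then have "d \<ge> 5"
      by (intro coprime_6_ge_5) auto
    then have "5 ^ 4 \<le> totient d ^ 5"
      using totient_power_lower_bound[OF d(3)] power_mono[of 5 d 4] by linarith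
    \<comment> \<open>A totient of at most 3 would give 5^4 <= 3^5.\<close>
    have "totient d \<ge> 4"
    proof (rule ccontr)
      assume "\<not> totient d \<ge> 4"
      then have "totient d ^ 5 \<le> 3 ^ 5"
        by (intro power_mono) auto
      with \<open>5 ^ 4 \<le> totient d ^ 5\<close> show False
        by simp
    qed
    then have "1 / real (totient d) \<le> 1 / 4"
      by (intro frac_le) auto
    then have w: "\<bar>ramanujan_weight n (b - m)\<bar> \<le> 1 / 4"
      using abs_ramanujan_weight_le[OF npos, of "b - m"] by (simp add: d_def)
    have "1 / real_of_int \<bar>m\<bar> \<le> 1"
      using mz by simp
    then have "\<bar>wave_coeff n m\<bar> \<le> 1"
      using abs_wave_coeff_le[OF m] by linarith
    then have "\<bar>wave_coeff n m * ramanujan_weight n (b - m)\<bar> \<le> 1 * (1 / 4)"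
      unfolding abs_mult using w by (intro mult_mono) auto
    then show ?thesis
      by (auto simp: abs_le_iff)
  qed
qed

lemma twisted_sum_ge:
  assumes n: "n > 10 ^ 20" "coprime n 6" and b: "\<not> [b = - 1] (mod int n)"
  shows "pi / 2 * twisted_sum n b / real (totient n) \<ge>
    (if [b = - 3] (mod int n) then - 1 / 3 else - 1 / 4) - 1 / 60"
proof -
  have "odd n" "n > 1"
    using n by (auto dest: coprime_common_divisor[of n 6 2])
  obtain m0 where "m0 \<in> odd_window n"
    "\<forall>m\<in>resonances n b. 2 * of_int \<bar>m\<bar> < sqrt (real n) \<longrightarrow> m = m0"
    "\<bar>(\<Sum>m\<in>odd_window n. wave_coeff n m * ramanujan_weight n (b - m)) -
       wave_coeff n m0 * ramanujan_weight n (b - m0)\<bar> \<le> 1 / 60"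
    by (rule wave_sum_main_term[OF n, of b])
  then show ?thesis
    using resonant_term_ge[OF n _ b, of m0]
    unfolding twisted_sum_window[OF \<open>odd n\<close> \<open>n > 1\<close>] by linarith
qed

text \<open>For b = 1 the frequency 1 is a small resonance, so it is the main term. Its weight is 1
  and its coefficient is close to 1.\<close>

lemma twisted_sum_1_ge:
  assumes n: "n > 10 ^ 20" "coprime n 6"
  shows "pi / 2 * twisted_sum n 1 / real (totient n) \<ge> 99 / 100 - 1 / 60"
proof -
  have odd: "odd n" "n > 1"
    using n by (auto dest: coprime_common_divisor[of n 6 2])
  have 1: "1 \<in> odd_window n"
    using n by (simp add: odd_window_def)
  have "reduced_denominator n (1 - 1) = 1"
    using odd by (simp add: reduced_denominator_def)
  then have "1 \<in> resonances n 1"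
    using 1 odd by (simp add: resonances_def)
  moreover have "2 * of_int \<bar>1\<bar> < sqrt (real n)"
    using n(1) by (simp add: real_less_rsqrt)
  moreover obtain m0 where m0: "m0 \<in> odd_window n"
    "\<forall>m\<in>resonances n 1. 2 * of_int \<bar>m\<bar> < sqrt (real n) \<longrightarrow> m = m0"
    "\<bar>(\<Sum>m\<in>odd_window n. wave_coeff n m * ramanujan_weight n (1 - m)) -
       wave_coeff n m0 * ramanujan_weight n (1 - m0)\<bar> \<le> 1 / 60"
    by (rule wave_sum_main_term[OF n, of 1])
  ultimately have "1 = m0"
    by blast
  note m0(3)[folded this]
  moreover have "ramanujan_weight n (1 - 1) = 1"
    using odd by (intro ramanujan_weight_eq_1) auto
  moreover have "wave_coeff n 1 \<ge> 99 / 100"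
  proof -
    have "pi / (2 * real n) \<le> 4 / (2 * 20)"
      using n(1) pi_less_4 by (intro frac_le) auto
    then have "(pi / (2 * real n))\<^sup>2 \<le> (1 / 10)\<^sup>2"
      by (intro power_mono) auto
    moreover have "1 - (pi / (2 * real n))\<^sup>2 / 2 \<le> wave_coeff n 1"
      using wave_coeff_bounds(3)[of 1 n] odd by simp
    moreover have "(1 / 10 :: real)\<^sup>2 = 1 / 100"
      by (simp add: power2_eq_square)
    ultimately show ?thesis
      by linarith
  qed
  ultimately show ?thesis
    unfolding twisted_sum_window[OF odd] by (simp only: mult_1_right)
qed

section \<open>Minimal zero-sum sequences\<close>

lemma twisted_sum_cong:
  assumes "n > 0" "[b = b'] (mod int n)"
  shows "twisted_sum n b = twisted_sum n b'"
proof -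
  have "sin (2 * pi * of_int (b * int x) / real n) = sin (2 * pi * of_int (b' * int x) / real n)" for x
    using arg_cong[OF unity_cong[OF assms(1) cong_scalar_right[OF assms(2), of "int x"]], of Im]
    by (simp add: unity_def)
  then show ?thesis
    by (simp add: twisted_sum_def)
qed

text \<open>The substitution y = a x permutes the units and moves the dilation from the wave to the
  sine, with v as the inverse of a.\<close>

lemma sum_sin_square_wave_dilated:
  assumes "n > 0" "coprime a n" "[int a * v = 1] (mod int n)"
  shows "(\<Sum>x\<in>units_below n. sin (2 * pi * of_int (c * int x) / real n) * square_wave n (a * x)) =
    twisted_sum n (c * v)"
proof -
  define f where "f y = Im (unity n (c * v * int y)) * square_wave n y" for y
  have "f (y mod n) = f y" for y
  proof -
    have "unity n (c * v * int (y mod n)) = unity n (c * v * int y)"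
      by (rule unity_cong[OF assms(1)]) (simp add: cong_def zmod_int mod_mult_right_eq)
    then show ?thesis
      by (simp add: f_def)
  qed
  moreover have "f (a * x) = sin (2 * pi * of_int (c * int x) / real n) * square_wave n (a * x)" for x
  proof -
    have "[c * int x * (int a * v) = c * int x * 1] (mod int n)"
      by (intro cong_mult cong_refl assms(3))
    then have "unity n (c * v * int (a * x)) = unity n (c * int x)"
      by (intro unity_cong[OF assms(1)]) (simp add: mult_ac)
    then show ?thesis
      by (simp add: f_def) (simp add: unity_def)
  qed
  ultimately show ?thesis
    using sum_units_below_mult[OF assms(1,2), of f]
    by (simp add: twisted_sum_def) (simp add: f_def unity_def)
qed

text \<open>Weighting the balance by the sine of frequency a makes the twisted sums at the ratios
  a/a, a/b, a/c and a/d cancel. If a/b is not -3, its term is at least -1/4, and the other negative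
  terms cannot compensate the one at the ratio 1.\<close>

lemma balanced_square_waves_imp_ratio:
  assumes n: "n > 10 ^ 20" "coprime n 6"
    and cop: "coprime a n" "coprime b n" "coprime c n" "coprime d n"
    and nonopposite: "\<not> n dvd a + b" "\<not> n dvd a + c" "\<not> n dvd a + d"
    and balanced: "\<And>g. coprime g n \<Longrightarrow>
      square_wave n (a * g) + square_wave n (b * g) + square_wave n (c * g) + square_wave n (d * g) = 0"
  shows "n dvd a + 3 * b"
proof (rule ccontr)
  assume not3: "\<not> n dvd a + 3 * b"
  define T where "T k = pi / 2 * twisted_sum n k / real (totient n)" for k
  have npos: "n > 0" using n by simp
  have "\<exists>v. [int u * v = 1] (mod int n)" if "coprime u n" for u
    using that cong_solve_coprime_int[of "int u" "int n"] by simp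
  then obtain va vb vc vd where v: "[int a * va = 1] (mod int n)" "[int b * vb = 1] (mod int n)"
      "[int c * vc = 1] (mod int n)" "[int d * vd = 1] (mod int n)"
    using cop by metis
  have ratio: "n dvd a + k * u" if "[int a * w = - int k] (mod int n)" "[int u * w = 1] (mod int n)" for u w k
  proof -
    have "[int u * (int a * w) = int u * - int k] (mod int n)"
      using that(1) by (rule cong_scalar_left)
    moreover have "[int a * (int u * w) = int a * 1] (mod int n)"
      using that(2) by (rule cong_scalar_left)
    ultimately have "[int a = - int (k * u)] (mod int n)"
      by (simp add: mult_ac) (metis cong_sym cong_trans)
    then have "int n dvd int (a + k * u)"
      by (simp add: cong_iff_dvd_diff)
    then show ?thesis
      by (simp only: int_dvd_int_iff)
  qed
  have T_ge: "T (int a * w) \<ge> - 1 / 3 - 1 / 60" if "[int u * w = 1] (mod int n)" "\<not> n dvd a + u" for u w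
  proof -
    have "\<not> [int a * w = - 1] (mod int n)"
      using ratio[of w 1 u] that by auto
    from twisted_sum_ge[OF n this] show ?thesis
      by (auto simp: T_def split: if_splits)
  qed
  have "(\<Sum>x\<in>units_below n. sin (2 * pi * of_int (int a * int x) / real n) *
      (square_wave n (a * x) + square_wave n (b * x) + square_wave n (c * x) + square_wave n (d * x))) = 0"
    using balanced by (intro sum.neutral) (simp add: units_below_def)
  then have "twisted_sum n (int a * va) + twisted_sum n (int a * vb) +
      twisted_sum n (int a * vc) + twisted_sum n (int a * vd) = 0"
    using sum_sin_square_wave_dilated[OF npos] cop v by (simp only: distrib_left sum.distrib)
  then have "pi / 2 * (twisted_sum n (int a * va) + twisted_sum n (int a * vb) +
      twisted_sum n (int a * vc) + twisted_sum n (int a * vd)) / real (totient n) = 0"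
    by simp
  then have "T (int a * va) + T (int a * vb) + T (int a * vc) + T (int a * vd) = 0"
    by (simp only: T_def distrib_left add_divide_distrib)
  moreover have "T (int a * va) \<ge> 99 / 100 - 1 / 60"
    using twisted_sum_1_ge[OF n] twisted_sum_cong[OF npos v(1)] by (simp add: T_def)
  moreover have "T (int a * vb) \<ge> - 1 / 4 - 1 / 60"
  proof -
    have "\<not> [int a * vb = - 1] (mod int n)" "\<not> [int a * vb = - 3] (mod int n)"
      using ratio[of vb 1 b] ratio[of vb 3 b] v nonopposite not3 by auto
    then show ?thesis
      using twisted_sum_ge[OF n, of "int a * vb"] by (simp add: T_def)
  qed
  moreover have "T (int a * vc) \<ge> - 1 / 3 - 1 / 60"
    using T_ge v nonopposite by blast
  moreover have "T (int a * vd) \<ge> - 1 / 3 - 1 / 60"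
    using T_ge v nonopposite by blast
  \<comment> \<open>The lower bounds add up to 99/100 - 1/4 - 2/3 - 4/60 = 1/150 > 0.\<close>
  ultimately show False
    by linarith
qed

section \<open>Residue sums of zero-sum sequences of length four\<close>

lemma real_double_mod:
  fixes n y :: nat
  assumes "odd n"
  shows "real (2 * y mod n) = 2 * real (y mod n) - real n * (1 - square_wave n y) / 2"
proof -
  define x where "x = y mod n"
  have x: "x < n"
    using assms by (auto simp: x_def intro: mod_less_divisor Nat.gr0I)
  have "2 * y mod n = 2 * x mod n"
    by (simp add: x_def mod_mult_right_eq)
  also have "\<dots> = (if 2 * x < n then 2 * x else 2 * x - n)"
    using x by (auto simp: mod_if)
  finally show ?thesis
    by (auto simp: square_wave_def x_def[symmetric] of_nat_diff)
qed

lemma residue_pos: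
  fixes n y :: nat
  assumes "coprime y n" "n > 1"
  shows "0 < y mod n" "y mod n < n"
proof -
  have "\<not> n dvd y"
    using assms coprime_absorb_right by fastforce
  then show "0 < y mod n"
    by (simp add: dvd_eq_mod_eq_0)
qed (use assms in simp)

text \<open>Among natural numbers, n - 1 stands for the unit -1.\<close>

lemma residue_complement:
  fixes n y :: nat
  assumes "coprime y n" "n > 1"
  shows "(n - 1) * y mod n + y mod n = n"
proof -
  have "n dvd (n - 1) * y + y"
  proof -
    have "(n - 1) * y + y = n * y"
      using assms(2) by (cases n) auto
    then show ?thesis by simp
  qed
  then have "n dvd (n - 1) * y mod n + y mod n"
    by (simp only: dvd_eq_mod_eq_0 mod_add_eq)
  then obtain k where k: "(n - 1) * y mod n + y mod n = n * k"
    by blast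
  have "(n - 1) * y mod n < n"
    using assms(2) by simp
  then have "n * 0 < n * k" "n * k < n * 2"
    using residue_pos[OF assms] unfolding k[symmetric] by linarith+
  then have "k = 1"
    using assms(2) by (metis One_nat_def Suc_1 less_2_cases mult_less_cancel1 neq0_conv)
  with k show ?thesis
    by simp
qed

lemma residue_sum_cases:
  fixes n a b c d g :: nat
  assumes "n dvd a + b + c + d"
    and cop: "coprime a n" "coprime b n" "coprime c n" "coprime d n" "coprime g n"
    and "n > 1"
  shows "g * a mod n + g * b mod n + g * c mod n + g * d mod n = n \<or>
    g * a mod n + g * b mod n + g * c mod n + g * d mod n = 2 * n \<or>
    g * a mod n + g * b mod n + g * c mod n + g * d mod n = 3 * n" (is "?f = n \<or> ?f = 2 * n \<or> ?f = 3 * n")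
proof -
  have "[?f = g * (a + b + c + d)] (mod n)"
    unfolding distrib_left by (intro cong_add) (simp_all add: cong_def)
  then have "n dvd ?f"
    using assms(1) by (simp add: cong_dvd_iff)
  then obtain k where k: "?f = n * k"
    by blast
  have bounds: "0 < w + x + y + z \<and> w + x + y + z < n * 4"
    if "0 < w" "w < n" "x < n" "y < n" "z < n" for w x y z
    using that by linarith
  have "0 < g * a mod n"
    using residue_pos[of "g * a" n] cop assms(7) by simp
  then have "0 < ?f \<and> ?f < n * 4"
    using assms(7) by (intro bounds) simp_all
  then have "0 < k" "k < 4"
    unfolding k by simp_all
  then have "k = 1 \<or> k = 2 \<or> k = 3"
    by linarith
  with k show ?thesis
    by auto
qed

lemma unit_with_residue_sum:
  fixes n a b c d :: nat
  assumes n: "n > 10 ^ 20" "coprime n 6"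
    and cop: "coprime a n" "coprime b n" "coprime c n" "coprime d n"
    and zero_sum: "n dvd a + b + c + d"
    and nonopposite: "\<not> n dvd a + b" "\<not> n dvd a + c" "\<not> n dvd a + d" "\<not> n dvd b + c" "\<not> n dvd b + d"
  obtains g where "coprime g n" "g * a mod n + g * b mod n + g * c mod n + g * d mod n = n"
proof (rule ccontr)
  assume "\<not> thesis"
  define f where "f g = g * a mod n + g * b mod n + g * c mod n + g * d mod n" for g
  have no: "f g \<noteq> n" if "coprime g n" for g
    using that \<open>\<not> thesis\<close> \<open>\<And>g. coprime g n \<Longrightarrow> g * a mod n + g * b mod n + g * c mod n + g * d mod n = n \<Longrightarrow> thesis\<close>
    unfolding f_def by blast
  have n1: "n > 1"
    using n(1) by simp
  have odd: "odd n"
    using n(2) by (auto dest: coprime_common_divisor[of n 6 2])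
  have f_cases: "f g = n \<or> f g = 2 * n \<or> f g = 3 * n" if g: "coprime g n" for g
    unfolding f_def using zero_sum cop g n1 by (rule residue_sum_cases)
  have "f g \<noteq> 3 * n" if g: "coprime g n" for g
  proof
    assume "f g = 3 * n"
    moreover have "f ((n - 1) * g) + f g = 4 * n"
    proof -
      have "(n - 1) * g * u mod n + g * u mod n = n" if "coprime u n" for u
        using residue_complement[of "g * u" n] g that n1 by (simp only: mult.assoc coprime_mult_left_iff)
      from this[OF cop(1)] this[OF cop(2)] this[OF cop(3)] this[OF cop(4)] show ?thesis
        unfolding f_def by linarith
    qed
    ultimately have "f ((n - 1) * g) = n"
      by simp
    moreover have "coprime ((n - 1) * g) n"
      using g n1 coprime_diff_one_left_nat[of n] by simp
    ultimately show False
      using no by blast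
  qed
  then have f: "f g = 2 * n" if "coprime g n" for g
    using f_cases no that by blast
  have balanced: "square_wave n (a * g) + square_wave n (b * g) + square_wave n (c * g) +
      square_wave n (d * g) = 0" if g: "coprime g n" for g
  proof -
    define t where "t u = square_wave n (u * g)" for u
    have double: "2 * real (2 * g * u mod n) = 4 * real (g * u mod n) - real n * (1 - t u)" for u
      using real_double_mod[OF odd, of "g * u"] by (simp add: t_def mult.assoc mult.commute[of u g])
    \<comment> \<open>As both residue sums turn out to be 2 n, this reads 4 n = 8 n - n (4 - s),
      where s is the sum of the four waves; hence s = 0.\<close>
    have "2 * real (f (2 * g)) = 4 * real (f g) - real n * (4 - (t a + t b + t c + t d))"
      unfolding f_def of_nat_add distrib_left double by (simp add: right_diff_distrib distrib_left)
    moreover have "coprime (2 * g) n"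
      using g odd by simp
    then have "f (2 * g) = 2 * n" "f g = 2 * n"
      using f g by blast+
    ultimately have "real n * (t a + t b + t c + t d) = 0"
      by (simp add: right_diff_distrib)
    then show ?thesis
      using n1 by (simp add: t_def)
  qed
  have "n dvd a + 3 * b"
    using n cop nonopposite(1-3) balanced by (rule balanced_square_waves_imp_ratio)
  \<comment> \<open>Exchanging the roles of a and b requires that b + c and b + d are not divisible
    by n either.\<close>
  moreover have "n dvd b + 3 * a"
  proof (rule balanced_square_waves_imp_ratio[OF n cop(2,1,3,4)])
    show "\<not> n dvd b + a"
      using nonopposite(1) by (simp add: add.commute)
    show "square_wave n (b * g) + square_wave n (a * g) + square_wave n (c * g) +
      square_wave n (d * g) = 0" if "coprime g n" for g
      using balanced[OF that] by simp
  qed (fact nonopposite)+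
  ultimately have "n dvd 3 * (b + 3 * a) - (a + 3 * b)"
    by (intro dvd_diff_nat dvd_mult)
  also have "3 * (b + 3 * a) - (a + 3 * b) = 8 * a"
    by simp
  finally have "n dvd 8"
    using cop(1) by (simp add: coprime_dvd_mult_left_iff coprime_commute)
  then show False
    using n(1) by (auto dest: dvd_imp_le)
qed

theorem theorem1:
  fixes n a1 a2 a3 a4 :: nat and S :: "nat multiset"
  assumes "n > 10 ^ 20"
    and "gcd n 6 = 1"
    and "S = {#a1, a2, a3, a4#}"
    and "seq_over n S"
    and "minimal_zero_sum n S"
    and "gcd n a1 = 1" and "gcd n a2 = 1" and "gcd n a3 = 1" and "gcd n a4 = 1"
  shows "ind n S = 1"
proof -
  define f where "f g = g * a1 mod n + g * a2 mod n + g * a3 mod n + g * a4 mod n" for g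
  have n: "n > 1" "coprime n 6"
    using assms(1,2) by (simp_all add: coprime_iff_gcd_eq_1)
  have cop: "coprime a1 n" "coprime a2 n" "coprime a3 n" "coprime a4 n"
    using assms(6-9) by (metis coprime_iff_gcd_eq_1 coprime_commute)+
  have zero_sum: "n dvd a1 + a2 + a3 + a4"
    using assms(3,5) by (simp add: minimal_zero_sum_def zero_sum_def cong_0_iff add.assoc)
  \<comment> \<open>Two opposite terms would form a proper zero-sum subsequence.\<close>
  have nonopposite: "\<not> n dvd x + y" if "S = {#x, y#} + {#z, w#}" for x y z w
  proof -
    have "{#x, y#} \<subset># S"
      unfolding that by (simp add: subset_mset_def)
    then show ?thesis
      using assms(5) by (auto simp: minimal_zero_sum_def zero_sum_def cong_0_iff)
  qed
  have "\<not> n dvd a1 + a2" "\<not> n dvd a1 + a3" "\<not> n dvd a1 + a4" "\<not> n dvd a2 + a3" "\<not> n dvd a2 + a4"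
    by (rule nonopposite, simp add: assms(3) add_mset_commute)+
  then obtain g where g: "coprime g n" "f g = n"
    unfolding f_def using unit_with_residue_sum[OF assms(1) n(2) cop zero_sum] by blast
  have ind_f: "ind n S = Min ((\<lambda>g. real (f g) / real n) ` totatives n)"
    by (simp add: ind_def assms(3) f_def add.assoc)
  show ?thesis
    unfolding ind_f
  proof (rule Min_eqI)
    fix y assume "y \<in> (\<lambda>g. real (f g) / real n) ` totatives n"
    then obtain h where h: "h \<in> totatives n" "y = real (f h) / real n"
      by blast
    then have "f h = n \<or> f h = 2 * n \<or> f h = 3 * n"
      unfolding f_def using residue_sum_cases[OF zero_sum cop _ n(1), of h] by (simp add: totatives_def)
    then show "1 \<le> y"
      using h(2) n(1) by auto
  next
    \<comment> \<open>The unit g is any natural number coprime to n, so it is first reduced to a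
      representative over which the minimum is taken.\<close>
    have "g mod n \<in> totatives n"
      using g(1) n(1) by (simp add: totatives_eq_units_below units_below_def)
    moreover have "f (g mod n) = n"
      using g(2) by (simp add: f_def mod_mult_left_eq)
    ultimately show "1 \<in> (\<lambda>g. real (f g) / real n) ` totatives n"
      using n(1) by (force simp: image_iff)
  qed simp
qed

end
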